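(* Let $f,g\in T(X,\mathcal{P})$. Then $(f,g)\in \mathcal{L}$ in $T(X,\mathcal{P})$ if and only if for each $i\in I$, there exist $j,k\in I$ such that $X_if\subseteq X_jg$ and $X_ig\subseteq X_kf$.
   Context: $X$ is a nonempty set (possibly infinite) and $\mathcal{P}=\{X_i : i\in I\}$ is a partition of $X$ into nonempty blocks, with $X_i\cap X_j=\varnothing$ for $i\neq j$. $T(X)$ denotes the semigroup of all maps $X\to X$ under composition. Maps are written on the right and composed from left to right: $x(fg)=(xf)g$; $Af=\{af: a\in A\}$. $T(X,\mathcal{P})$ is the subsemigroup (containing $\mathrm{id}_X$) of all $f\in T(X)$ such that for every $i\in I$ there is $j\in I$ with $X_if\subseteq X_j$. In a semigroup $S$ with identity, Green's relation $\mathcal{L}$ is: $(a,b)\in\mathcal{L}$ iff $Sa=Sb$. *)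

theory Defs
  imports "HOL-Algebra.Coset" "HOL-Library.Disjoint_Sets"
begin

definition indexed_partition :: "'a set \<Rightarrow> 'i set \<Rightarrow> ('i \<Rightarrow> 'a set) \<Rightarrow> bool" where
  "indexed_partition X I B \<longleftrightarrow>
     (\<Union>i\<in>I. B i) = X \<and> (\<forall>i\<in>I. B i \<noteq> {}) \<and> disjoint_family_on B I"

(* Maps on X are the extensional functions in X \<rightarrow>\<^sub>E X. Maps are written on the right and composed
   from left to right, so the product fg is "first f, then g", i.e. compose X g f. *)
definition full_transf :: "'a set \<Rightarrow> ('a \<Rightarrow> 'a) monoid" where
  "full_transf X =
     \<lparr>carrier = X \<rightarrow>\<^sub>E X, mult = (\<lambda>f g. compose X g f), one = (\<lambda>x\<in>X. x)\<rparr>"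

definition partition_transf :: "'a set \<Rightarrow> 'i set \<Rightarrow> ('i \<Rightarrow> 'a set) \<Rightarrow> ('a \<Rightarrow> 'a) monoid" where
  "partition_transf X I B =
     (full_transf X)\<lparr>carrier := {f \<in> carrier (full_transf X). \<forall>i\<in>I. \<exists>j\<in>I. f ` B i \<subseteq> B j}\<rparr>"

(* carrier S #>\<^bsub>S\<^esub> a is the principal left ideal Sa = {s \<otimes> a | s in S}. *)
definition green_L :: "('a, 'b) monoid_scheme \<Rightarrow> ('a \<times> 'a) set" where
  "green_L S = {(a, b). a \<in> carrier S \<and> b \<in> carrier S \<and>
     carrier S #>\<^bsub>S\<^esub> a = carrier S #>\<^bsub>S\<^esub> b}"

lemma monoid_full_transf: "monoid (full_transf X)"
  by (rule monoidI)
    (auto simp: full_transf_def compose_def PiE_iff fun_eq_iff extensional_def)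

lemma submonoid_partition_transf:
  assumes "indexed_partition X I B"
  shows "submonoid (carrier (partition_transf X I B)) (full_transf X)"
proof
  have BX: "B i \<subseteq> X" if "i \<in> I" for i
    using assms that by (auto simp: indexed_partition_def)
  show "carrier (partition_transf X I B) \<subseteq> carrier (full_transf X)"
    by (auto simp: partition_transf_def)
  show "\<one>\<^bsub>full_transf X\<^esub> \<in> carrier (partition_transf X I B)"
    using BX by (fastforce simp: partition_transf_def full_transf_def)
  fix f g assume fg: "f \<in> carrier (partition_transf X I B)" "g \<in> carrier (partition_transf X I B)"
  have "\<exists>k\<in>I. compose X g f ` B i \<subseteq> B k" if i: "i \<in> I" for i
  proof -
    obtain j where j: "j \<in> I" "f ` B i \<subseteq> B j"
      using fg i by (auto simp: partition_transf_def)
    obtain k where k: "k \<in> I" "g ` B j \<subseteq> B k"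
      using fg j by (auto simp: partition_transf_def)
    have "compose X g f ` B i = g ` f ` B i"
      using BX[OF i] by (auto simp: compose_def image_iff subset_iff) 
    then show ?thesis using j k by blast
  qed
  moreover have "compose X g f \<in> X \<rightarrow>\<^sub>E X"
    using fg by (auto simp: partition_transf_def full_transf_def compose_def PiE_iff extensional_def)
  ultimately show "f \<otimes>\<^bsub>full_transf X\<^esub> g \<in> carrier (partition_transf X I B)"
    by (auto simp: partition_transf_def full_transf_def)
qed

lemma monoid_partition_transf:
  "indexed_partition X I B \<Longrightarrow> monoid (partition_transf X I B)"
  using submonoid.submonoid_is_monoid[OF submonoid_partition_transf monoid_full_transf]
  by (simp add: partition_transf_def)

end

theory Submission
  imports Defs
begin

text \<open>Since \<open>T(X, \<P>)\<close> is a monoid, two elements are \<open>\<L>\<close>-related exactly when each of them is a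
left multiple of the other, so everything reduces to describing when \<open>f = s \<otimes> g\<close> has a solution
\<open>s\<close> in \<open>T(X, \<P>)\<close>. As maps are composed from left to right, such an \<open>s\<close> picks for every point
\<open>x\<close> a \<open>g\<close>-preimage of \<open>f x\<close>; that \<open>s\<close> preserves the partition means that for the points of one
block all these preimages can be picked in one block. Hence the condition is that \<open>f\<close> sends every
block into the \<open>g\<close>-image of a block (lemma \<open>left_multiple_iff_block_images_subset\<close>). The theorem
is this criterion applied to \<open>(f, g)\<close> and to \<open>(g, f)\<close>.\<close>

text \<open>The identity puts \<open>a\<close> into its own principal left ideal, and conversely a left multiple of a
left multiple of \<open>b\<close> is a left multiple of \<open>b\<close> by associativity.\<close>

lemma (in monoid) green_L_iff_left_multiples:
  assumes "a \<in> carrier G" "b \<in> carrier G"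
  shows "(a, b) \<in> green_L G \<longleftrightarrow> a \<in> carrier G #> b \<and> b \<in> carrier G #> a"
proof -
  have self: "x \<in> carrier G #> x" if "x \<in> carrier G" for x
    unfolding r_coset_def using that by (auto intro!: bexI[of _ "\<one>"])
  have mono: "carrier G #> x \<subseteq> carrier G #> y"
    if "x \<in> carrier G #> y" "y \<in> carrier G" for x y
    using that unfolding r_coset_def by (auto simp: m_assoc[symmetric])
  show ?thesis
    using assms self mono unfolding green_L_def by blast
qed

lemma mem_partition_transf_iff:
  "s \<in> carrier (partition_transf X I B) \<longleftrightarrow>
     s \<in> X \<rightarrow>\<^sub>E X \<and> (\<forall>i\<in>I. \<exists>j\<in>I. s ` B i \<subseteq> B j)"
  by (simp add: partition_transf_def full_transf_def)

lemma mem_left_multiples_partition_transf_iff: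
  "f \<in> carrier (partition_transf X I B) #>\<^bsub>partition_transf X I B\<^esub> g \<longleftrightarrow>
     (\<exists>s\<in>carrier (partition_transf X I B). f = compose X g s)"
  by (simp add: r_coset_def partition_transf_def full_transf_def)

text \<open>If \<open>f\<close> first applies \<open>s\<close> and then \<open>g\<close>, the block into which \<open>s\<close> maps \<open>B i\<close> has the required
image. Conversely, \<open>s\<close> is built by two choices: a block \<open>B (J i)\<close> for every \<open>i\<close>, and then, for every
\<open>x \<in> B i\<close>, a \<open>g\<close>-preimage of \<open>f x\<close> in \<open>B (J i)\<close>.\<close>

lemma left_multiple_iff_block_images_subset:
  assumes part: "indexed_partition X I B" and ext: "f \<in> extensional X"
  shows "f \<in> carrier (partition_transf X I B) #>\<^bsub>partition_transf X I B\<^esub> g \<longleftrightarrow>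
    (\<forall>i\<in>I. \<exists>j\<in>I. f ` B i \<subseteq> g ` B j)"
proof -
  have BX: "B i \<subseteq> X" if "i \<in> I" for i
    using part that by (auto simp: indexed_partition_def)
  show ?thesis
    unfolding mem_left_multiples_partition_transf_iff
  proof
    assume "\<exists>s\<in>carrier (partition_transf X I B). f = compose X g s"
    then obtain s where s: "\<And>i. i \<in> I \<Longrightarrow> \<exists>j\<in>I. s ` B i \<subseteq> B j" and f: "f = compose X g s"
      using mem_partition_transf_iff by metis
    show "\<forall>i\<in>I. \<exists>j\<in>I. f ` B i \<subseteq> g ` B j"
    proof
      fix i assume i: "i \<in> I"
      obtain j where j: "j \<in> I" "s ` B i \<subseteq> B j"
        using s[OF i] by blast
      have "f ` B i = g ` s ` B i"
        using BX[OF i] by (force simp: f compose_def image_image)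
      with j show "\<exists>j\<in>I. f ` B i \<subseteq> g ` B j" by blast
    qed
  next
    assume "\<forall>i\<in>I. \<exists>j\<in>I. f ` B i \<subseteq> g ` B j"
    then obtain J where J: "\<And>i. i \<in> I \<Longrightarrow> J i \<in> I" "\<And>i. i \<in> I \<Longrightarrow> f ` B i \<subseteq> g ` B (J i)"
      by metis
    \<comment> \<open>The requirement ranges over all blocks that contain \<open>x\<close>; disjointness leaves only one.\<close>
    have "\<exists>y. (\<forall>i\<in>I. x \<in> B i \<longrightarrow> y \<in> B (J i)) \<and> g y = f x" if "x \<in> X" for x
    proof -
      obtain i where i: "i \<in> I" "x \<in> B i"
        using part \<open>x \<in> X\<close> by (auto simp: indexed_partition_def)
      then have unique: "k = i" if "k \<in> I" "x \<in> B k" for k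
        using part that by (auto simp: indexed_partition_def disjoint_family_on_def)
      obtain y where "y \<in> B (J i)" "g y = f x"
        using J(2)[OF i(1)] i(2) by (metis image_eqI imageE subsetD)
      with unique show ?thesis by blast
    qed
    then obtain t where t_block: "\<And>x i. x \<in> X \<Longrightarrow> i \<in> I \<Longrightarrow> x \<in> B i \<Longrightarrow> t x \<in> B (J i)"
      and g_t: "\<And>x. x \<in> X \<Longrightarrow> g (t x) = f x"
      by metis
    define s where "s = restrict t X"
    have s_block: "s ` B i \<subseteq> B (J i)" if "i \<in> I" for i
      using BX[OF that] t_block that by (auto simp: s_def)
    have "s x \<in> X" if "x \<in> X" for x
    proof -
      obtain i where "i \<in> I" "x \<in> B i"
        using part \<open>x \<in> X\<close> by (auto simp: indexed_partition_def)
      with s_block J(1) BX show ?thesis by blast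
    qed
    then have "s \<in> X \<rightarrow>\<^sub>E X"
      by (auto simp: s_def)
    with s_block J(1) have "s \<in> carrier (partition_transf X I B)"
      unfolding mem_partition_transf_iff by blast
    moreover have "f = compose X g s"
      using ext g_t by (auto simp: s_def compose_def extensional_def fun_eq_iff)
    ultimately show "\<exists>s\<in>carrier (partition_transf X I B). f = compose X g s"
      by blast
  qed
qed

theorem proposition5p4:
  fixes X :: "'a set" and I :: "'i set" and B :: "'i \<Rightarrow> 'a set" and f g :: "'a \<Rightarrow> 'a"
  assumes "X \<noteq> {}"
    and "indexed_partition X I B"
    and "f \<in> carrier (partition_transf X I B)"
    and "g \<in> carrier (partition_transf X I B)"
  shows "(f, g) \<in> green_L (partition_transf X I B) \<longleftrightarrow>
    (\<forall>i\<in>I. \<exists>j\<in>I. \<exists>k\<in>I. f ` B i \<subseteq> g ` B j \<and> g ` B i \<subseteq> f ` B k)"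
proof -
  have "f \<in> extensional X" "g \<in> extensional X"
    using assms(3,4) by (auto simp: mem_partition_transf_iff PiE_iff)
  then show ?thesis
    unfolding monoid.green_L_iff_left_multiples[OF monoid_partition_transf[OF assms(2)] assms(3,4)]
      left_multiple_iff_block_images_subset[OF assms(2) \<open>f \<in> extensional X\<close>]
      left_multiple_iff_block_images_subset[OF assms(2) \<open>g \<in> extensional X\<close>]
    by blast
qed

end
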